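(* Let $s,t$ be nonnegative integers with $s+t\le N$, let $\sigma,\tau$ be nonnegative integers with $\sigma+\tau\le N$, and put $r=N-s-t$, $\rho=N-\sigma-\tau$, $S=p_1+p_2+p_3+p_4$. Then the following hold. (i) $$\begin{aligned}(s-\tfrac N3)P(s,t,\sigma,\tau)=\ &\sigma\tfrac{p_3(p_1p_4-p_2p_3)}{(p_1+p_2)(p_1+p_3)(p_3+p_4)}P(s,t,\sigma-1,\tau)+\tau\tfrac{p_1(p_2p_3-p_1p_4)}{(p_1+p_2)(p_1+p_3)(p_3+p_4)}P(s,t,\sigma,\tau-1)\\&+\rho\tfrac{p_1p_2p_3S}{(p_1+p_2)(p_1+p_3)(p_1p_4-p_2p_3)}P(s,t,\sigma+1,\tau)-\tau\tfrac{p_1p_2}{(p_1+p_2)(p_1+p_3)}P(s,t,\sigma+1,\tau-1)\\&+\rho\tfrac{p_1p_3p_4S}{(p_1+p_3)(p_3+p_4)(p_2p_3-p_1p_4)}P(s,t,\sigma,\tau+1)-\sigma\tfrac{p_3p_4}{(p_1+p_3)(p_3+p_4)}P(s,t,\sigma-1,\tau+1)\\&+\Big[(\sigma-\tfrac N3)\Big(\tfrac{p_2p_3}{(p_1+p_2)(p_1+p_3)}-\tfrac{p_1p_3S}{(p_1+p_2)(p_1+p_3)(p_3+p_4)}\Big)\\&\quad+(\tau-\tfrac N3)\Big(\tfrac{p_1p_4}{(p_1+p_3)(p_3+p_4)}-\tfrac{p_1p_3S}{(p_1+p_2)(p_1+p_3)(p_3+p_4)}\Big)\Big]P(s,t,\sigma,\tau).\end{aligned}$$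 (ii) $$\begin{aligned}(t-\tfrac N3)P(s,t,\sigma,\tau)=\ &\sigma\tfrac{p_4(p_2p_3-p_1p_4)}{(p_1+p_2)(p_2+p_4)(p_3+p_4)}P(s,t,\sigma-1,\tau)+\tau\tfrac{p_2(p_1p_4-p_2p_3)}{(p_1+p_2)(p_2+p_4)(p_3+p_4)}P(s,t,\sigma,\tau-1)\\&+\rho\tfrac{p_1p_2p_4S}{(p_1+p_2)(p_2+p_4)(p_2p_3-p_1p_4)}P(s,t,\sigma+1,\tau)-\tau\tfrac{p_1p_2}{(p_1+p_2)(p_2+p_4)}P(s,t,\sigma+1,\tau-1)\\&+\rho\tfrac{p_2p_3p_4S}{(p_2+p_4)(p_3+p_4)(p_1p_4-p_2p_3)}P(s,t,\sigma,\tau+1)-\sigma\tfrac{p_3p_4}{(p_2+p_4)(p_3+p_4)}P(s,t,\sigma-1,\tau+1)\\&+\Big[(\sigma-\tfrac N3)\Big(\tfrac{p_1p_4}{(p_1+p_2)(p_2+p_4)}-\tfrac{p_2p_4S}{(p_1+p_2)(p_2+p_4)(p_3+p_4)}\Big)\\&\quad+(\tau-\tfrac N3)\Big(\tfrac{p_2p_3}{(p_2+p_4)(p_3+p_4)}-\tfrac{p_2p_4S}{(p_1+p_2)(p_2+p_4)(p_3+p_4)}\Big)\Big]P(s,t,\sigma,\tau).\end{aligned}$$ (iii) $$\begin{aligned}(\sigma-\tfrac N3)P(s,t,\sigma,\tau)=\ &s\tfrac{p_2(p_1p_4-p_2p_3)}{(p_1+p_2)(p_1+p_3)(p_2+p_4)}P(s-1,t,\sigma,\tau)+t\tfrac{p_1(p_2p_3-p_1p_4)}{(p_1+p_2)(p_1+p_3)(p_2+p_4)}P(s,t-1,\sigma,\tau)\\&+r\tfrac{p_1p_2p_3S}{(p_1+p_2)(p_1+p_3)(p_1p_4-p_2p_3)}P(s+1,t,\sigma,\tau)-t\tfrac{p_1p_3}{(p_1+p_2)(p_1+p_3)}P(s+1,t-1,\sigma,\tau)\\&+r\tfrac{p_1p_2p_4S}{(p_1+p_2)(p_2+p_4)(p_2p_3-p_1p_4)}P(s,t+1,\sigma,\tau)-s\tfrac{p_2p_4}{(p_1+p_2)(p_2+p_4)}P(s-1,t+1,\sigma,\tau)\\&+\Big[(s-\tfrac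 N3)\Big(\tfrac{p_2p_3}{(p_1+p_2)(p_1+p_3)}-\tfrac{p_1p_2S}{(p_1+p_2)(p_1+p_3)(p_2+p_4)}\Big)\\&\quad+(t-\tfrac N3)\Big(\tfrac{p_1p_4}{(p_1+p_2)(p_2+p_4)}-\tfrac{p_1p_2S}{(p_1+p_2)(p_1+p_3)(p_2+p_4)}\Big)\Big]P(s,t,\sigma,\tau).\end{aligned}$$ (iv) $$\begin{aligned}(\tau-\tfrac N3)P(s,t,\sigma,\tau)=\ &s\tfrac{p_4(p_2p_3-p_1p_4)}{(p_1+p_3)(p_3+p_4)(p_2+p_4)}P(s-1,t,\sigma,\tau)+t\tfrac{p_3(p_1p_4-p_2p_3)}{(p_1+p_3)(p_3+p_4)(p_2+p_4)}P(s,t-1,\sigma,\tau)\\&+r\tfrac{p_1p_3p_4S}{(p_1+p_3)(p_3+p_4)(p_2p_3-p_1p_4)}P(s+1,t,\sigma,\tau)-t\tfrac{p_1p_3}{(p_1+p_3)(p_3+p_4)}P(s+1,t-1,\sigma,\tau)\\&+r\tfrac{p_2p_3p_4S}{(p_2+p_4)(p_3+p_4)(p_1p_4-p_2p_3)}P(s,t+1,\sigma,\tau)-s\tfrac{p_2p_4}{(p_2+p_4)(p_3+p_4)}P(s-1,t+1,\sigma,\tau)\\&+\Big[(s-\tfrac N3)\Big(\tfrac{p_1p_4}{(p_1+p_3)(p_3+p_4)}-\tfrac{p_3p_4S}{(p_1+p_3)(p_3+p_4)(p_2+p_4)}\Big)\\&\quad+(t-\tfrac N3)\Big(\tfrac{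p_2p_3}{(p_2+p_4)(p_3+p_4)}-\tfrac{p_3p_4S}{(p_1+p_3)(p_3+p_4)(p_2+p_4)}\Big)\Big]P(s,t,\sigma,\tau).\end{aligned}$$
   Context: Let $p_1,p_2,p_3,p_4\in\mathbb C$ be such that all of $p_1,\ p_2,\ p_3,\ p_4,\ p_1+p_2,\ p_1+p_3,\ p_2+p_4,\ p_3+p_4,\ p_1+p_2+p_3+p_4,\ p_1p_4-p_2p_3$ are nonzero, and let $N\ge 0$ be an integer. Put $S=p_1+p_2+p_3+p_4$ and $$\mathbf t=\tfrac{(p_1+p_2)(p_1+p_3)}{p_1S},\quad \mathbf u=\tfrac{(p_1+p_3)(p_3+p_4)}{p_3S},\quad \mathbf v=\tfrac{(p_1+p_2)(p_2+p_4)}{p_2S},\quad \mathbf w=\tfrac{(p_2+p_4)(p_3+p_4)}{p_4S}.$$ With $(\alpha)_n=\alpha(\alpha+1)\cdots(\alpha+n-1)$, define the polynomial $$P(a,b,c,d)=\sum_{\substack{i,j,k,\ell\ge 0\\ i+j+k+\ell\le N}}\frac{(-a)_{i+j}(-b)_{k+\ell}(-c)_{i+k}(-d)_{j+\ell}}{i!\,j!\,k!\,\ell!\,(-N)_{i+j+k+\ell}}\,\mathbf t^i\mathbf u^j\mathbf v^k\mathbf w^\ell ,$$ which may be evaluated at arbitrary complex (in particular integer) arguments. Terms whose arguments fall outside the range (e.g. $\sigma-1<0$, or $\sigma+1+\tau>N$) occur with coefficient $0$. *)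

theory Defs
  imports Complex_Main
begin

definition rahman_t :: "complex \<Rightarrow> complex \<Rightarrow> complex \<Rightarrow> complex \<Rightarrow> complex" where
  "rahman_t p1 p2 p3 p4 = (p1 + p2) * (p1 + p3) / (p1 * (p1 + p2 + p3 + p4))"

definition rahman_u :: "complex \<Rightarrow> complex \<Rightarrow> complex \<Rightarrow> complex \<Rightarrow> complex" where
  "rahman_u p1 p2 p3 p4 = (p1 + p3) * (p3 + p4) / (p3 * (p1 + p2 + p3 + p4))"

definition rahman_v :: "complex \<Rightarrow> complex \<Rightarrow> complex \<Rightarrow> complex \<Rightarrow> complex" where
  "rahman_v p1 p2 p3 p4 = (p1 + p2) * (p2 + p4) / (p2 * (p1 + p2 + p3 + p4))"

definition rahman_w :: "complex \<Rightarrow> complex \<Rightarrow> complex \<Rightarrow> complex \<Rightarrow> complex" where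
  "rahman_w p1 p2 p3 p4 = (p2 + p4) * (p3 + p4) / (p4 * (p1 + p2 + p3 + p4))"

definition rahman_indices :: "nat \<Rightarrow> (nat \<times> nat \<times> nat \<times> nat) set" where
  "rahman_indices N = {(i, j, k, l). i + j + k + l \<le> N}"

(* Without finiteness the sum in the next definition would be 0 by convention. *)
lemma finite_rahman_indices: "finite (rahman_indices N)"
proof (rule finite_subset)
  show "rahman_indices N \<subseteq> {..N} \<times> {..N} \<times> {..N} \<times> {..N}"
    by (auto simp: rahman_indices_def)
qed simp

(* The denominator (-N)_(i+j+k+l) is nonzero since i + j + k + l \<le> N. *)
definition rahman_poly ::
  "complex \<Rightarrow> complex \<Rightarrow> complex \<Rightarrow> complex \<Rightarrow> nat \<Rightarrow>
   complex \<Rightarrow> complex \<Rightarrow> complex \<Rightarrow> complex \<Rightarrow> complex" where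
  "rahman_poly p1 p2 p3 p4 N a b c d =
    (\<Sum>(i, j, k, l) \<in> rahman_indices N.
       (pochhammer (- a) (i + j) * pochhammer (- b) (k + l) *
        pochhammer (- c) (i + k) * pochhammer (- d) (j + l)) /
       (fact i * fact j * fact k * fact l * pochhammer (- of_nat N) (i + j + k + l)) *
       rahman_t p1 p2 p3 p4 ^ i * rahman_u p1 p2 p3 p4 ^ j *
       rahman_v p1 p2 p3 p4 ^ k * rahman_w p1 p2 p3 p4 ^ l)"

end

(*
Put Q(X, Y) = (1 - t X - u Y)^a (1 - v X - w Y)^b. Then P(a,b,c,d) is the image of Q under the
linear functional X^m Y^n |-> K(m,n) = (-c)_m (-d)_n / (-N)_{m+n}. The difference operator in
(c,d) on the right-hand side of (i) acts on K as the transpose of a first-order derivation in X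
and Y, plus the scalar -N/3. The parameters make this derivation fix
1 - t X - u Y and kill 1 - v X - w Y, so Q is an eigenvector with eigenvalue a. The other three
identities follow from (i) by the symmetries p1 <-> p2, p3 <-> p4 and p2 <-> p3 of P.
*)
theory Submission
  imports Defs
begin

section \<open>Sums against the coefficients of a power of 1 - t X - u Y\<close>

text \<open>The weight (-a)_{i+j} t^i u^j / (i! j!) is the coefficient of X^i Y^j in phi^a, where
  phi = 1 - t X - u Y. For a <= M this is the image of phi^a under the functional X^i Y^j |-> f i j,
  so operators on polynomials turn into transposed operators on \<open>f\<close>.\<close>

definition trinomial_sum :: "nat \<Rightarrow> nat \<Rightarrow> complex \<Rightarrow> complex \<Rightarrow> (nat \<Rightarrow> nat \<Rightarrow> complex) \<Rightarrow> complex" where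
  "trinomial_sum M a t u f =
    (\<Sum>i\<le>M. \<Sum>j\<le>M. pochhammer (- of_nat a) (i + j) / (fact i * fact j) * t ^ i * u ^ j * f i j)"

lemma trinomial_sum_add:
  "trinomial_sum M a t u (\<lambda>i j. f i j + g i j) = trinomial_sum M a t u f + trinomial_sum M a t u g"
  by (simp add: trinomial_sum_def distrib_left sum.distrib)

lemma trinomial_sum_cmult:
  "trinomial_sum M a t u (\<lambda>i j. c * f i j) = c * trinomial_sum M a t u f"
  by (simp add: trinomial_sum_def sum_distrib_left algebra_simps)

lemma trinomial_sum_swap:
  "trinomial_sum M a t u f = trinomial_sum M a u t (\<lambda>i j. f j i)"
  unfolding trinomial_sum_def
  by (subst sum.swap) (simp add: add.commute mult.commute mult.left_commute)

text \<open>The factor (-a)_{i+j} vanishes for i + j > a. Later this confines the kernel identities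
  to the range where their denominators are nonzero.\<close>

lemma trinomial_sum_cong:
  assumes "\<And>i j. i + j \<le> a \<Longrightarrow> f i j = g i j"
  shows "trinomial_sum M a t u f = trinomial_sum M a t u g"
  unfolding trinomial_sum_def
proof (intro sum.cong refl)
  fix i j
  show "pochhammer (- of_nat a) (i + j) / (fact i * fact j) * t ^ i * u ^ j * f i j =
      pochhammer (- of_nat a) (i + j) / (fact i * fact j) * t ^ i * u ^ j * g i j"
    using assms[of i j] by (cases "i + j \<le> a") (auto simp: pochhammer_of_nat_eq_0_iff)
qed

text \<open>The transpose of d/dX phi^a = t (E - a) phi^a, where E = X d/dX + Y d/dY is the Euler
  operator. Writing -a phi^(a-1) as (E - a) phi^a keeps the exponent a in all sums.\<close>

lemma trinomial_sum_shift:
  assumes "a < M"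
  shows "trinomial_sum M a t u (\<lambda>i j. of_nat i * f (i - 1) j) =
    t * trinomial_sum M a t u (\<lambda>i j. (of_nat (i + j) - of_nat a) * f i j)"
proof -
  define T :: "nat \<Rightarrow> nat \<Rightarrow> complex" where
    "T i j = pochhammer (- of_nat a) (i + j) / (fact i * fact j) * t ^ i * u ^ j" for i j
  obtain M' where M: "M = Suc M'" using assms by (cases M) auto
  have T_Suc: "of_nat (Suc i) * T (Suc i) j = t * (of_nat (i + j) - of_nat a) * T i j" for i j
  proof -
    have "of_nat (Suc i) \<noteq> (0 :: complex)" by (simp only: of_nat_eq_0_iff)
    then show ?thesis
      by (simp add: T_def pochhammer_rec' field_simps del: of_nat_Suc)
  qed
  \<comment> \<open>The index shift loses the term i = M, whose coefficient is zero because M >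
    a.\<close>
  have T_last: "(of_nat (M + j) - of_nat a) * T M j = 0" for j
    using assms by (simp add: T_def pochhammer_of_nat_eq_0_iff)
  have "(\<Sum>i\<le>M. T i j * (of_nat i * f (i - 1) j)) =
      t * (\<Sum>i\<le>M. T i j * ((of_nat (i + j) - of_nat a) * f i j))" for j
  proof -
    have "(\<Sum>i\<le>M. T i j * (of_nat i * f (i - 1) j)) =
        (\<Sum>i\<le>M'. (of_nat (Suc i) * T (Suc i) j) * f i j)"
      unfolding M by (subst sum.atMost_Suc_shift) (simp add: algebra_simps)
    also have "\<dots> = (\<Sum>i\<le>M'. t * (T i j * ((of_nat (i + j) - of_nat a) * f i j)))"
      unfolding T_Suc by (simp add: algebra_simps)
    also have "\<dots> = t * (\<Sum>i\<le>M'. T i j * ((of_nat (i + j) - of_nat a) * f i j))"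
      by (simp add: sum_distrib_left)
    also have "(\<Sum>i\<le>M'. T i j * ((of_nat (i + j) - of_nat a) * f i j)) =
        (\<Sum>i\<le>M. T i j * ((of_nat (i + j) - of_nat a) * f i j))"
      using T_last[of j] unfolding M by (simp add: mult.assoc[symmetric] mult.commute[of "T (Suc M') j"] del: of_nat_add)
    finally show ?thesis .
  qed
  then show ?thesis
    unfolding trinomial_sum_def T_def[symmetric]
    by (subst (1 2) sum.swap) (simp add: sum_distrib_left)
qed

lemma trinomial_sum_shift2:
  assumes "a < M"
  shows "trinomial_sum M a t u (\<lambda>i j. of_nat j * f i (j - 1)) =
    u * trinomial_sum M a t u (\<lambda>i j. (of_nat (i + j) - of_nat a) * f i j)"
  by (subst (1 2) trinomial_sum_swap)
    (use trinomial_sum_shift[OF assms, of u t "\<lambda>i j. f j i"] in \<open>simp add: add.commute\<close>)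

text \<open>The weights i + j - a produce (E - a) phi^a = -a phi^(a-1), and the combination of
  shifts of \<open>f\<close> is the transpose of multiplication by phi, which restores the
  exponent.\<close>

lemma trinomial_sum_euler:
  assumes "a < M"
  shows "trinomial_sum M a t u
      (\<lambda>i j. (of_nat (i + j) - of_nat a) * (f i j - t * f (Suc i) j - u * f i (Suc j))) =
    - of_nat a * trinomial_sum M a t u f"
proof -
  let ?G = "trinomial_sum M a t u"
  let ?w = "\<lambda>i j. of_nat (i + j) - of_nat a :: complex"
  \<comment> \<open>The shift lemma is read backwards for (i, j) |-> f (i + 1) j; at i = 0 the
    truncated predecessor is masked by the factor i.\<close>
  have 1: "t * ?G (\<lambda>i j. ?w i j * f (Suc i) j) = ?G (\<lambda>i j. of_nat i * f i j)"
    by (subst trinomial_sum_shift[OF assms, symmetric], rule trinomial_sum_cong)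
      (metis Suc_pred' mult_eq_0_iff not_gr_zero of_nat_0)
  have 2: "u * ?G (\<lambda>i j. ?w i j * f i (Suc j)) = ?G (\<lambda>i j. of_nat j * f i j)"
    by (subst trinomial_sum_shift2[OF assms, symmetric], rule trinomial_sum_cong)
      (metis Suc_pred' mult_eq_0_iff not_gr_zero of_nat_0)
  have "?G (\<lambda>i j. ?w i j * (f i j - t * f (Suc i) j - u * f i (Suc j))) =
      ?G (\<lambda>i j. ?w i j * f i j + (- t) * (?w i j * f (Suc i) j) + (- u) * (?w i j * f i (Suc j)))"
    by (intro trinomial_sum_cong) (simp add: algebra_simps)
  also have "\<dots> = ?G (\<lambda>i j. ?w i j * f i j) - ?G (\<lambda>i j. of_nat i * f i j) - ?G (\<lambda>i j. of_nat j * f i j)"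
    unfolding trinomial_sum_add trinomial_sum_cmult using 1 2 by simp
  also have "\<dots> = ?G (\<lambda>i j. ?w i j * f i j + (- 1) * (of_nat i * f i j) + (- 1) * (of_nat j * f i j))"
    unfolding trinomial_sum_add trinomial_sum_cmult by simp
  also have "\<dots> = ?G (\<lambda>i j. - of_nat a * f i j)"
    by (intro trinomial_sum_cong) (simp add: algebra_simps)
  finally show ?thesis by (simp only: trinomial_sum_cmult)
qed

section \<open>Sums against the coefficients of a product of two powers\<close>

text \<open>The image of phi^a psi^b, with psi = 1 - v X - w Y, under X^m Y^n |-> f m n.\<close>

definition double_sum ::
  "nat \<Rightarrow> nat \<Rightarrow> nat \<Rightarrow> complex \<Rightarrow> complex \<Rightarrow> complex \<Rightarrow> complex \<Rightarrow> (nat \<Rightarrow> nat \<Rightarrow> complex) \<Rightarrow> complex" where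
  "double_sum M a b t u v w f =
    trinomial_sum M a t u (\<lambda>i j. trinomial_sum M b v w (\<lambda>k l. f (i + k) (j + l)))"

lemma double_sum_add:
  "double_sum M a b t u v w (\<lambda>m n. f m n + g m n) =
    double_sum M a b t u v w f + double_sum M a b t u v w g"
  by (simp add: double_sum_def trinomial_sum_add)

lemma double_sum_cmult:
  "double_sum M a b t u v w (\<lambda>m n. c * f m n) = c * double_sum M a b t u v w f"
  by (simp add: double_sum_def trinomial_sum_cmult)

lemma double_sum_cong:
  assumes "\<And>m n. m + n \<le> a + b \<Longrightarrow> f m n = g m n"
  shows "double_sum M a b t u v w f = double_sum M a b t u v w g"
  unfolding double_sum_def
  by (intro trinomial_sum_cong assms) simp

text \<open>The product rule for d/dX: the exponent i + k splits into one derivative for each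
  factor, and the shift lemma rewrites each of them.\<close>

lemma double_sum_shift:
  assumes "a < M" "b < M"
  shows "double_sum M a b t u v w (\<lambda>m n. of_nat m * f (m - 1) n) =
    t * trinomial_sum M a t u (\<lambda>i j. (of_nat (i + j) - of_nat a) *
          trinomial_sum M b v w (\<lambda>k l. f (i + k) (j + l))) +
    v * trinomial_sum M a t u (\<lambda>i j.
          trinomial_sum M b v w (\<lambda>k l. (of_nat (k + l) - of_nat b) * f (i + k) (j + l)))"
proof -
  let ?H = "trinomial_sum M b v w"
  have "?H (\<lambda>k l. of_nat (i + k) * f (i + k - 1) (j + l)) =
      of_nat i * ?H (\<lambda>k l. f (i - 1 + k) (j + l)) +
      v * ?H (\<lambda>k l. (of_nat (k + l) - of_nat b) * f (i + k) (j + l))" for i j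
  proof -
    have "?H (\<lambda>k l. of_nat (i + k) * f (i + k - 1) (j + l)) =
        ?H (\<lambda>k l. of_nat i * f (i - 1 + k) (j + l) + of_nat k * f (i + (k - 1)) (j + l))"
    proof (rule trinomial_sum_cong)
      fix k l
      show "of_nat (i + k) * f (i + k - 1) (j + l) =
          of_nat i * f (i - 1 + k) (j + l) + of_nat k * f (i + (k - 1)) (j + l)"
        by (cases i; cases k) (simp_all add: algebra_simps)
    qed
    then show ?thesis
      unfolding trinomial_sum_add trinomial_sum_cmult
      using trinomial_sum_shift[OF assms(2), of v w "\<lambda>k l. f (i + k) (j + l)"] by simp
  qed
  then have "double_sum M a b t u v w (\<lambda>m n. of_nat m * f (m - 1) n) =
      trinomial_sum M a t u (\<lambda>i j. of_nat i * ?H (\<lambda>k l. f (i - 1 + k) (j + l))) +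
      v * trinomial_sum M a t u (\<lambda>i j. ?H (\<lambda>k l. (of_nat (k + l) - of_nat b) * f (i + k) (j + l)))"
    unfolding double_sum_def by (simp only: trinomial_sum_add trinomial_sum_cmult)
  then show ?thesis
    using trinomial_sum_shift[OF assms(1), of t u "\<lambda>i j. ?H (\<lambda>k l. f (i + k) (j + l))"] by simp
qed

lemma double_sum_swap:
  "double_sum M a b t u v w f = double_sum M a b u t w v (\<lambda>m n. f n m)"
  unfolding double_sum_def
  by (subst trinomial_sum_swap, subst trinomial_sum_swap) (rule refl)

lemma double_sum_shift2:
  assumes "a < M" "b < M"
  shows "double_sum M a b t u v w (\<lambda>m n. of_nat n * f m (n - 1)) =
    u * trinomial_sum M a t u (\<lambda>i j. (of_nat (i + j) - of_nat a) *
          trinomial_sum M b v w (\<lambda>k l. f (i + k) (j + l))) +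
    w * trinomial_sum M a t u (\<lambda>i j.
          trinomial_sum M b v w (\<lambda>k l. (of_nat (k + l) - of_nat b) * f (i + k) (j + l)))"
proof -
  note swap = trinomial_sum_swap[of M b v w] trinomial_sum_swap[of M a t u]
  show ?thesis
    unfolding swap double_sum_swap[of M a b t]
    using double_sum_shift[OF assms, of u t w v "\<lambda>m n. f n m"]
    by (simp only: add.commute)
qed

text \<open>The condition on \<open>x\<close> and \<open>y\<close> says that the derivation sending \<open>X\<close> to \<open>x \<phi>\<close> and \<open>Y\<close> to
  \<open>y \<phi>\<close>, where \<open>\<phi> = 1 - t X - u Y\<close>, fixes \<open>\<phi>\<close> and kills \<open>1 - v X - w Y\<close>.\<close>

lemma double_sum_eigen:
  fixes f :: "nat \<Rightarrow> nat \<Rightarrow> complex"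
  assumes "a < M" "b < M" "t * x + u * y = - 1" "v * x + w * y = 0"
  defines "g \<equiv> \<lambda>m n. f m n - t * f (Suc m) n - u * f m (Suc n)"
  shows "double_sum M a b t u v w
      (\<lambda>m n. x * (of_nat m * g (m - 1) n) + y * (of_nat n * g m (n - 1))) =
    of_nat a * double_sum M a b t u v w f"
proof -
  let ?G = "trinomial_sum M a t u" and ?H = "trinomial_sum M b v w"
  \<comment> \<open>The two halves of the product rule, multiplied by phi through \<open>g\<close>:
    \<open>A\<close> is the image of phi ((E - a) phi^a) psi^b = -a phi^a psi^b, and
    \<open>B\<close> that of phi^(a+1) (E - b) psi^b. The hypotheses on \<open>x\<close> and
    \<open>y\<close> give them the coefficients -1 and 0.\<close>
  define A where "A = ?G (\<lambda>i j. (of_nat (i + j) - of_nat a) * ?H (\<lambda>k l. g (i + k) (j + l)))"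
  define B where "B = ?G (\<lambda>i j. ?H (\<lambda>k l. (of_nat (k + l) - of_nat b) * g (i + k) (j + l)))"
  have "?H (\<lambda>k l. g (i + k) (j + l)) = ?H (\<lambda>k l. f (i + k) (j + l)) -
      t * ?H (\<lambda>k l. f (Suc i + k) (j + l)) - u * ?H (\<lambda>k l. f (i + k) (Suc j + l))" for i j
  proof -
    have "?H (\<lambda>k l. g (i + k) (j + l)) = ?H (\<lambda>k l. f (i + k) (j + l) +
        (- t) * f (Suc i + k) (j + l) + (- u) * f (i + k) (Suc j + l))"
      by (simp add: g_def)
    then show ?thesis unfolding trinomial_sum_add trinomial_sum_cmult by simp
  qed
  then have A: "A = - of_nat a * double_sum M a b t u v w f"
    unfolding A_def double_sum_def
    using trinomial_sum_euler[OF assms(1), of t u "\<lambda>i j. ?H (\<lambda>k l. f (i + k) (j + l))"] by simp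
  have "double_sum M a b t u v w
      (\<lambda>m n. x * (of_nat m * g (m - 1) n) + y * (of_nat n * g m (n - 1))) =
      x * (t * A + v * B) + y * (u * A + w * B)"
    unfolding double_sum_add double_sum_cmult double_sum_shift[OF assms(1,2)]
      double_sum_shift2[OF assms(1,2)] A_def B_def ..
  also have "\<dots> = (t * x + u * y) * A + (v * x + w * y) * B" by (simp add: algebra_simps)
  finally show ?thesis using assms(3,4) A by simp
qed

section \<open>Contiguity relations of the kernel\<close>

text \<open>For m + n > N the denominator is zero, and so is the value, by the convention for
  division. Complex \<open>c\<close> and \<open>d\<close> give a meaning to shifted arguments such
  as -1.\<close>

definition rahman_kernel :: "nat \<Rightarrow> complex \<Rightarrow> complex \<Rightarrow> nat \<Rightarrow> nat \<Rightarrow> complex" where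
  "rahman_kernel N c d m n = pochhammer (- c) m * pochhammer (- d) n / pochhammer (- of_nat N) (m + n)"

lemma rahman_kernel_swap: "rahman_kernel N c d m n = rahman_kernel N d c n m"
  by (simp add: rahman_kernel_def add.commute mult.commute)

text \<open>Multiplication by c is traded for operators in m and n. Below the boundary both sides
  are -(-c)_{m+1} (-d)_n / (-N)_{m+n}.\<close>

lemma rahman_kernel_Suc:
  assumes "c + d \<le> N"
  shows "(of_nat c - of_nat m) * rahman_kernel N (of_nat c) (of_nat d) m n =
    (of_nat N - of_nat m - of_nat n) * rahman_kernel N (of_nat c) (of_nat d) (Suc m) n"
proof (cases "m + n < N")
  case True
  then have "pochhammer (- of_nat N :: complex) (m + n) \<noteq> 0"
    by (simp add: pochhammer_of_nat_eq_0_iff)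
  moreover have "of_nat N - of_nat m - of_nat n \<noteq> (0 :: complex)"
  proof -
    have "of_nat N \<noteq> (of_nat (m + n) :: complex)" using True by (simp only: of_nat_eq_iff)
    then show ?thesis by (simp add: algebra_simps)
  qed
  moreover have "- of_nat N + of_nat (m + n) \<noteq> (0 :: complex)"
    using calculation(2) by (simp add: algebra_simps)
  ultimately show ?thesis
    by (simp add: rahman_kernel_def pochhammer_rec' divide_simps) (simp add: algebra_simps)
next
  case False
  \<comment> \<open>Here m + n >= N. If m < c, then n > d because c + d <= N, so (-d)_n = 0; if m >
    c, then (-c)_m = 0.\<close>
  have "(of_nat c - of_nat m) * (pochhammer (- of_nat c) m * pochhammer (- of_nat d) n) = (0 :: complex)"
    using False assms by (cases "c = m") (auto simp: pochhammer_of_nat_eq_0_iff)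
  then have "(of_nat c - of_nat m) * rahman_kernel N (of_nat c) (of_nat d) m n = 0"
    by (simp add: rahman_kernel_def)
  \<comment> \<open>The denominator (-N)_{m+n+1} is zero, so the default value 0 of the quotient is
    used.\<close>
  moreover have "rahman_kernel N (of_nat c) (of_nat d) (Suc m) n = 0"
    using False by (simp add: rahman_kernel_def pochhammer_of_nat_eq_0_iff)
  ultimately show ?thesis by simp
qed

lemma rahman_kernel_Suc2:
  assumes "c + d \<le> N"
  shows "(of_nat d - of_nat n) * rahman_kernel N (of_nat c) (of_nat d) m n =
    (of_nat N - of_nat m - of_nat n) * rahman_kernel N (of_nat c) (of_nat d) m (Suc n)"
  using rahman_kernel_Suc[of d c N n m] assms
  by (simp add: rahman_kernel_swap[of N "of_nat c"] algebra_simps)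

text \<open>Both c (1 - c)_m and (c - m) (-c)_m equal -(-c)_{m+1}.\<close>

lemma rahman_kernel_minus_one:
  "c * rahman_kernel N (c - 1) d m n = (c - of_nat m) * rahman_kernel N c d m n"
proof -
  have "c * pochhammer (1 - c) m = (c - of_nat m) * pochhammer (- c) m"
    using pochhammer_rec[of "- c" m] pochhammer_rec'[of "- c" m] by (simp add: algebra_simps)
  then show ?thesis by (simp add: rahman_kernel_def flip: mult.assoc)
qed

lemma rahman_kernel_minus_one2:
  "d * rahman_kernel N c (d - 1) m n = (d - of_nat n) * rahman_kernel N c d m n"
  using rahman_kernel_minus_one[of d N c n m] by (simp add: rahman_kernel_swap[of N c])

text \<open>A Pascal rule, (-c-1)_m = (-c)_m - m (-c)_{m-1}, combined with (-N)_{m+n} = (m + n - 1 -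
  N) (-N)_{m+n-1}.\<close>

lemma rahman_kernel_plus_one:
  assumes "m + n \<le> N"
  shows "(of_nat N + 1 - of_nat m - of_nat n) * rahman_kernel N (c + 1) d m n =
    (of_nat N + 1 - of_nat m - of_nat n) * rahman_kernel N c d m n +
    of_nat m * rahman_kernel N c d (m - 1) n"
proof (cases m)
  case 0
  then show ?thesis by (simp add: rahman_kernel_def)
next
  case (Suc k)
  have nz: "pochhammer (- of_nat N :: complex) (k + n) \<noteq> 0"
    using assms Suc by (simp add: pochhammer_of_nat_eq_0_iff)
  have nz2: "pochhammer (- of_nat N :: complex) (Suc (k + n)) \<noteq> 0"
    using assms Suc by (simp add: pochhammer_of_nat_eq_0_iff)
  have nz3: "- of_nat N + of_nat (k + n) \<noteq> (0 :: complex)"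
    using nz2 by (simp add: pochhammer_rec' add.commute)
  define q :: complex where "q = - of_nat N + of_nat (k + n)"
  have "pochhammer (- (c + 1)) (Suc k) = (- c - 1) * pochhammer (- c) k"
    using pochhammer_rec[of "- (c + 1)" k] by simp
  then have 1: "pochhammer (- (c + 1)) (Suc k) =
      pochhammer (- c) (Suc k) - of_nat (Suc k) * pochhammer (- c) k"
    by (simp add: pochhammer_rec' algebra_simps)
  have 2: "pochhammer (- of_nat N :: complex) (Suc k + n) = q * pochhammer (- of_nat N) (k + n)"
    by (simp add: pochhammer_rec' q_def)
  have 3: "of_nat N + 1 - of_nat m - of_nat n = - q"
    by (simp add: q_def Suc)
  have "q \<noteq> 0" using nz3 by (simp add: q_def)
  then show ?thesis
    using nz unfolding 3 unfolding Suc rahman_kernel_def 1 2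
    by (simp add: field_simps)
qed

text \<open>Split N - c - d as (N - m - n) - (c - m) - (d - n).\<close>

lemma rahman_kernel_rho:
  assumes "c + d \<le> N"
  shows "(of_nat N - of_nat c - of_nat d) * rahman_kernel N (of_nat c) (of_nat d) m n =
    (of_nat N - of_nat m - of_nat n) *
      (rahman_kernel N (of_nat c) (of_nat d) m n - rahman_kernel N (of_nat c) (of_nat d) (Suc m) n
       - rahman_kernel N (of_nat c) (of_nat d) m (Suc n))"
proof -
  let ?K = "rahman_kernel N (of_nat c) (of_nat d)"
  have "(of_nat N - of_nat c - of_nat d) * ?K m n = (of_nat N - of_nat m - of_nat n) * ?K m n
      - (of_nat c - of_nat m) * ?K m n - (of_nat d - of_nat n) * ?K m n"
    by (simp add: algebra_simps)
  then show ?thesis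
    unfolding rahman_kernel_Suc[OF assms] rahman_kernel_Suc2[OF assms]
    by (simp only: right_diff_distrib)
qed

text \<open>Raising c divides by N + 1 - m - n. A prefactor y that produces this factor on K(m - 1,
  n) cancels the division; N - c - d and d - n are such prefactors.\<close>

lemma rahman_kernel_plus_one_cancel:
  assumes "m + n \<le> N"
    and "0 < m \<Longrightarrow> y * rahman_kernel N c d (m - 1) n = (of_nat N + 1 - of_nat m - of_nat n) * z"
  shows "y * rahman_kernel N (c + 1) d m n = y * rahman_kernel N c d m n + of_nat m * z"
proof -
  let ?q = "of_nat N + 1 - of_nat m - of_nat n :: complex"
  have "of_nat (Suc N) \<noteq> (of_nat (m + n) :: complex)"
    using assms(1) by (simp only: of_nat_eq_iff)
  then have q: "?q \<noteq> 0" by (simp add: algebra_simps)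
  have "?q * (y * rahman_kernel N (c + 1) d m n) =
      y * (?q * rahman_kernel N c d m n + of_nat m * rahman_kernel N c d (m - 1) n)"
    unfolding rahman_kernel_plus_one[OF assms(1), symmetric] by simp
  also have "\<dots> = ?q * (y * rahman_kernel N c d m n) + of_nat m * (y * rahman_kernel N c d (m - 1) n)"
    by (simp only: distrib_left mult.left_commute)
  also have "of_nat m * (y * rahman_kernel N c d (m - 1) n) = of_nat m * (?q * z)"
    using assms(2) by (cases "m = 0") simp_all
  also have "?q * (y * rahman_kernel N c d m n) + of_nat m * (?q * z) =
      ?q * (y * rahman_kernel N c d m n + of_nat m * z)"
    by (simp only: distrib_left mult.left_commute)
  finally show ?thesis using q by simp
qed

lemma rahman_kernel_rho_plus_one:
  assumes "c + d \<le> N" "m + n \<le> N"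
  defines "K \<equiv> rahman_kernel N (of_nat c) (of_nat d)"
  shows "(of_nat N - of_nat c - of_nat d) * rahman_kernel N (of_nat c + 1) (of_nat d) m n =
    (of_nat N - of_nat m - of_nat n) * (K m n - K (Suc m) n - K m (Suc n)) +
    of_nat m * (K (m - 1) n - K m n - K (m - 1) (Suc n))"
proof -
  have "(of_nat N - of_nat c - of_nat d) * K (m - 1) n =
      (of_nat N + 1 - of_nat m - of_nat n) * (K (m - 1) n - K m n - K (m - 1) (Suc n))" if "0 < m"
    using rahman_kernel_rho[OF assms(1), of "m - 1" n] that
    by (cases m) (simp_all add: K_def algebra_simps)
  from rahman_kernel_plus_one_cancel[OF assms(2) this[unfolded K_def]] show ?thesis
    using rahman_kernel_rho[OF assms(1), of m n] unfolding K_def by simp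
qed

text \<open>Lowering d turns the prefactor d into d - n, which then cancels the division caused by
  raising c.\<close>

lemma rahman_kernel_transfer:
  assumes "c + d \<le> N" "m + n \<le> N"
  defines "K \<equiv> rahman_kernel N (of_nat c) (of_nat d)"
  shows "of_nat d * rahman_kernel N (of_nat c + 1) (of_nat d - 1) m n =
    (of_nat N - of_nat m - of_nat n) * K m (Suc n) + of_nat m * K (m - 1) (Suc n)"
proof -
  have "(of_nat d - of_nat n) * K (m - 1) n =
      (of_nat N + 1 - of_nat m - of_nat n) * K (m - 1) (Suc n)" if "0 < m"
    using rahman_kernel_Suc2[OF assms(1), of n "m - 1"] that
    by (cases m) (simp_all add: K_def algebra_simps)
  from rahman_kernel_plus_one_cancel[OF assms(2) this[unfolded K_def]] show ?thesis
    using rahman_kernel_Suc2[OF assms(1), of n m]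
    unfolding K_def rahman_kernel_minus_one2 by simp
qed

lemma rahman_kernel_rho_plus_one2:
  assumes "c + d \<le> N" "m + n \<le> N"
  defines "K \<equiv> rahman_kernel N (of_nat c) (of_nat d)"
  shows "(of_nat N - of_nat c - of_nat d) * rahman_kernel N (of_nat c) (of_nat d + 1) m n =
    (of_nat N - of_nat m - of_nat n) * (K m n - K (Suc m) n - K m (Suc n)) +
    of_nat n * (K m (n - 1) - K m n - K (Suc m) (n - 1))"
  using rahman_kernel_rho_plus_one[of d c N n m] assms(1,2)
  by (simp add: K_def rahman_kernel_swap[of N "of_nat c"] algebra_simps)

lemma rahman_kernel_transfer2:
  assumes "c + d \<le> N" "m + n \<le> N"
  defines "K \<equiv> rahman_kernel N (of_nat c) (of_nat d)"
  shows "of_nat c * rahman_kernel N (of_nat c - 1) (of_nat d + 1) m n =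
    (of_nat N - of_nat m - of_nat n) * K (Suc m) n + of_nat n * K (Suc m) (n - 1)"
  using rahman_kernel_transfer[of d c N n m] assms(1,2)
  by (simp add: K_def rahman_kernel_swap[of N "of_nat c"] rahman_kernel_swap[of N "of_nat c - 1"] algebra_simps)

section \<open>The polynomial as a double sum, and its symmetries\<close>

lemma rahman_poly_eq_double_sum:
  assumes "a + b \<le> N"
  shows "rahman_poly p1 p2 p3 p4 N (of_nat a) (of_nat b) c d =
    double_sum (Suc N) a b (rahman_t p1 p2 p3 p4) (rahman_u p1 p2 p3 p4)
      (rahman_v p1 p2 p3 p4) (rahman_w p1 p2 p3 p4) (rahman_kernel N c d)"
proof -
  let ?t = "rahman_t p1 p2 p3 p4" and ?u = "rahman_u p1 p2 p3 p4"
  let ?v = "rahman_v p1 p2 p3 p4" and ?w = "rahman_w p1 p2 p3 p4"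
  \<comment> \<open>The bound N + 1 is strictly larger than a and b, as the shift lemmas
    require.\<close>
  let ?B = "{..Suc N}"
  let ?F = "\<lambda>(i, j, k, l). (pochhammer (- of_nat a) (i + j) * pochhammer (- of_nat b) (k + l) *
        pochhammer (- c) (i + k) * pochhammer (- d) (j + l)) /
       (fact i * fact j * fact k * fact l * pochhammer (- of_nat N) (i + j + k + l)) *
       ?t ^ i * ?u ^ j * ?v ^ k * ?w ^ l :: complex"
  have "rahman_poly p1 p2 p3 p4 N (of_nat a) (of_nat b) c d = sum ?F (rahman_indices N)"
    by (simp add: rahman_poly_def)
  also have "\<dots> = sum ?F (?B \<times> ?B \<times> ?B \<times> ?B)"
  proof (rule sum.mono_neutral_left)
    show "rahman_indices N \<subseteq> ?B \<times> ?B \<times> ?B \<times> ?B" by (auto simp: rahman_indices_def)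
    \<comment> \<open>Outside the index set (-N)_{i+j+k+l} = 0, so the quotient is 0 by convention.
      Since a + b <= N, the numerator vanishes there as well.\<close>
    show "\<forall>x \<in> ?B \<times> ?B \<times> ?B \<times> ?B - rahman_indices N. ?F x = 0"
      by (auto simp: rahman_indices_def pochhammer_of_nat_eq_0_iff)
  qed simp
  also have "\<dots> = (\<Sum>i\<le>Suc N. \<Sum>j\<le>Suc N. \<Sum>k\<le>Suc N. \<Sum>l\<le>Suc N. ?F (i, j, k, l))"
    by (simp only: sum.cartesian_product' case_prod_unfold fst_conv snd_conv)
  also have "\<dots> = double_sum (Suc N) a b ?t ?u ?v ?w (rahman_kernel N c d)"
    unfolding double_sum_def trinomial_sum_def rahman_kernel_def sum_distrib_left
    by (intro sum.cong refl) (simp add: ac_simps)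
  finally show ?thesis .
qed

text \<open>The substitution swaps t with v and u with w, that is, phi with psi.\<close>

lemma rahman_poly_swap_pairs:
  "rahman_poly p2 p1 p4 p3 N b a c d = rahman_poly p1 p2 p3 p4 N a b c d"
  unfolding rahman_poly_def
  by (rule sum.reindex_bij_witness[of _ "\<lambda>(i, j, k, l). (k, l, i, j)" "\<lambda>(i, j, k, l). (k, l, i, j)"])
    (auto simp: rahman_indices_def rahman_t_def rahman_u_def rahman_v_def rahman_w_def ac_simps)

text \<open>The substitution fixes t and w and swaps u with v. It transposes the matrix with rows
  (i, j) and (k, l), whose row sums belong to a, b and column sums to c, d.\<close>

lemma rahman_poly_transpose:
  "rahman_poly p1 p3 p2 p4 N c d a b = rahman_poly p1 p2 p3 p4 N a b c d"
  unfolding rahman_poly_def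
  by (rule sum.reindex_bij_witness[of _ "\<lambda>(i, j, k, l). (i, k, j, l)" "\<lambda>(i, j, k, l). (i, k, j, l)"])
    (auto simp: rahman_indices_def rahman_t_def rahman_u_def rahman_v_def rahman_w_def ac_simps)

section \<open>The recurrence with undetermined coefficients\<close>

text \<open>The hypotheses match coefficients with the transpose of phi (A3 d/dX + A5 d/dY) - N/3:
  \<open>A1\<close> and \<open>A2\<close> remove the forward shifts, \<open>B\<close> fixes the
  scalar, \<open>B1\<close> and \<open>B2\<close> the diagonal terms in m and n, \<open>A4\<close>
  and \<open>A6\<close> the mixed shifts. \<open>tu\<close> and \<open>vw\<close> are the
  eigenvector conditions.\<close>

lemma double_sum_rahman_kernel_recurrence:
  fixes A1 A2 A3 A4 A5 A6 B1 B2 :: complex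
  assumes "a + b \<le> N" "c + d \<le> N"
    and B: "B1 + B2 - 1 = 3 * (A3 + A5)"
    and A1: "A1 - A3 - A5 - A6 + B1 = 0" and A2: "A2 - A3 - A4 - A5 + B2 = 0"
    and B1: "B1 - 2 * A3 - A5 = - t * A3" and B2: "B2 - A3 - 2 * A5 = - u * A5"
    and A4: "A3 + A4 = u * A3" and A6: "A5 + A6 = t * A5"
    and tu: "t * A3 + u * A5 = - 1" and vw: "v * A3 + w * A5 = 0"
  defines "\<Phi> \<equiv> \<lambda>c d. double_sum (Suc N) a b t u v w (rahman_kernel N c d)"
    and "n3 \<equiv> of_nat N / 3"
    and "x \<equiv> of_nat c" and "y \<equiv> of_nat d"
  shows "(of_nat a - n3) * \<Phi> x y =
    x * A1 * \<Phi> (x - 1) y + y * A2 * \<Phi> x (y - 1)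
    + (of_nat N - x - y) * A3 * \<Phi> (x + 1) y - y * A4 * \<Phi> (x + 1) (y - 1)
    + (of_nat N - x - y) * A5 * \<Phi> x (y + 1) - x * A6 * \<Phi> (x - 1) (y + 1)
    + ((x - n3) * B1 + (y - n3) * B2) * \<Phi> x y"
proof -
  let ?D = "double_sum (Suc N) a b t u v w"
  define K where "K = rahman_kernel N x y"
  define g where "g m n = K m n - t * K (Suc m) n - u * K m (Suc n)" for m n
  define L where "L m n =
    A1 * (x * rahman_kernel N (x - 1) y m n) + A2 * (y * rahman_kernel N x (y - 1) m n)
    + A3 * ((of_nat N - x - y) * rahman_kernel N (x + 1) y m n)
    + (- A4) * (y * rahman_kernel N (x + 1) (y - 1) m n)
    + A5 * ((of_nat N - x - y) * rahman_kernel N x (y + 1) m n)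
    + (- A6) * (x * rahman_kernel N (x - 1) (y + 1) m n)
    + ((x - n3) * B1 + (y - n3) * B2) * K m n" for m n
  have L: "L m n = - n3 * K m n + (A3 * (of_nat m * g (m - 1) n) + A5 * (of_nat n * g m (n - 1)))"
    if mn: "m + n \<le> a + b" for m n
  proof -
    have le: "m + n \<le> N" using mn assms(1) by simp
    define q :: complex where "q = of_nat N - of_nat m - of_nat n"
    \<comment> \<open>The coefficients x and y are eliminated, leaving operators in m and n that do
      not involve them.\<close>
    have xK: "x * K m n = of_nat m * K m n + q * K (Suc m) n"
      using rahman_kernel_Suc[OF assms(2), of m n]
      by (simp add: K_def x_def y_def q_def algebra_simps)
    have yK: "y * K m n = of_nat n * K m n + q * K m (Suc n)"
      using rahman_kernel_Suc2[OF assms(2), of n m]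
      by (simp add: K_def x_def y_def q_def algebra_simps)
    have 1: "x * rahman_kernel N (x - 1) y m n = q * K (Suc m) n"
      using xK by (simp add: rahman_kernel_minus_one K_def algebra_simps)
    have 2: "y * rahman_kernel N x (y - 1) m n = q * K m (Suc n)"
      using yK by (simp add: rahman_kernel_minus_one2 K_def algebra_simps)
    have "L m n =
        A1 * (q * K (Suc m) n) + A2 * (q * K m (Suc n))
        + A3 * (q * (K m n - K (Suc m) n - K m (Suc n)) +
            of_nat m * (K (m - 1) n - K m n - K (m - 1) (Suc n)))
        + (- A4) * (q * K m (Suc n) + of_nat m * K (m - 1) (Suc n))
        + A5 * (q * (K m n - K (Suc m) n - K m (Suc n)) +
            of_nat n * (K m (n - 1) - K m n - K (Suc m) (n - 1)))
        + (- A6) * (q * K (Suc m) n + of_nat n * K (Suc m) (n - 1))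
        + (B1 * (x * K m n) + B2 * (y * K m n) - n3 * (B1 + B2) * K m n)"
      unfolding L_def 1 2
      using rahman_kernel_rho_plus_one[OF assms(2) le] rahman_kernel_transfer[OF assms(2) le]
        rahman_kernel_rho_plus_one2[OF assms(2) le] rahman_kernel_transfer2[OF assms(2) le]
      by (simp add: K_def x_def y_def q_def left_diff_distrib distrib_right mult.commute mult.left_commute)
        (simp add: algebra_simps)
    also have "\<dots> = (A1 - A3 - A5 - A6 + B1) * (q * K (Suc m) n)
        + (A2 - A3 - A4 - A5 + B2) * (q * K m (Suc n))
        + ((of_nat N - of_nat m - of_nat n) * (A3 + A5) - n3 * (B1 + B2)
            + of_nat m * (B1 - A3) + of_nat n * (B2 - A5)) * K m n
        + of_nat m * (A3 * K (m - 1) n - (A3 + A4) * K (m - 1) (Suc n))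
        + of_nat n * (A5 * K m (n - 1) - (A5 + A6) * K (Suc m) (n - 1))"
      unfolding xK yK by (simp add: q_def algebra_simps)
    \<comment> \<open>With N = 3 \<open>n3\<close>, the constant part is a multiple of
      \<open>n3\<close>, and \<open>B\<close> makes it exactly -\<open>n3\<close>.\<close>
    also have "(of_nat N - of_nat m - of_nat n) * (A3 + A5) - n3 * (B1 + B2)
            + of_nat m * (B1 - A3) + of_nat n * (B2 - A5) =
        - n3 * (B1 + B2 - 3 * (A3 + A5))
            + of_nat m * (B1 - 2 * A3 - A5) + of_nat n * (B2 - A3 - 2 * A5)"
      by (simp add: n3_def algebra_simps)
    also have "B1 + B2 - 3 * (A3 + A5) = 1"
      using B by (simp add: algebra_simps)
    also have "(A1 - A3 - A5 - A6 + B1) * (q * K (Suc m) n)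
        + (A2 - A3 - A4 - A5 + B2) * (q * K m (Suc n))
        + (- n3 * 1 + of_nat m * (B1 - 2 * A3 - A5) + of_nat n * (B2 - A3 - 2 * A5)) * K m n
        + of_nat m * (A3 * K (m - 1) n - (A3 + A4) * K (m - 1) (Suc n))
        + of_nat n * (A5 * K m (n - 1) - (A5 + A6) * K (Suc m) (n - 1)) =
      - n3 * K m n
        + of_nat m * (A3 * K (m - 1) n - t * A3 * K m n - u * A3 * K (m - 1) (Suc n))
        + of_nat n * (A5 * K m (n - 1) - t * A5 * K (Suc m) (n - 1) - u * A5 * K m n)"
      unfolding A1 A2 A4 A6 B1 B2 by (simp add: algebra_simps)
    also have "\<dots> = - n3 * K m n + (A3 * (of_nat m * g (m - 1) n) + A5 * (of_nat n * g m (n - 1)))"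
      by (cases m; cases n) (simp_all add: g_def algebra_simps)
    finally show ?thesis .
  qed
  have "?D L = ?D (\<lambda>m n. - n3 * K m n +
      (A3 * (of_nat m * g (m - 1) n) + A5 * (of_nat n * g m (n - 1))))"
    by (rule double_sum_cong) (rule L)
  also have "\<dots> = - n3 * ?D K + of_nat a * ?D K"
  proof -
    have "a < Suc N" "b < Suc N" using assms(1) by simp_all
    from double_sum_eigen[OF this tu vw, of K] show ?thesis
      unfolding g_def by (simp only: double_sum_add[of _ _ _ _ _ _ _ "\<lambda>m n. - n3 * K m n"] double_sum_cmult)
  qed
  finally have "(of_nat a - n3) * ?D K = ?D L" by (simp add: algebra_simps)
  also have "?D L =
    A1 * (x * \<Phi> (x - 1) y) + A2 * (y * \<Phi> x (y - 1)) + A3 * ((of_nat N - x - y) * \<Phi> (x + 1) y)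
    + (- A4) * (y * \<Phi> (x + 1) (y - 1)) + A5 * ((of_nat N - x - y) * \<Phi> x (y + 1))
    + (- A6) * (x * \<Phi> (x - 1) (y + 1)) + ((x - n3) * B1 + (y - n3) * B2) * ?D K"
    unfolding L_def \<Phi>_def by (simp only: double_sum_add double_sum_cmult)
  finally show ?thesis
    by (simp add: \<Phi>_def K_def algebra_simps)
qed

section \<open>The first identity: verification of its coefficients\<close>

text \<open>\<open>A3\<close> and \<open>A5\<close> solve the linear system \<open>tu\<close>,
  \<open>vw\<close>, whose determinant t w - u v is a nonzero multiple of p1 p4 - p2 p3. The rest
  follows from them: A4 = (u - 1) A3, A6 = (t - 1) A5, C1 = (1 - t) A3, C2 = (1 - u) A5, C3 = -(A3 +
  A5), A1 = A6 - C1 and A2 = A4 - C2.\<close>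

lemma rahman_poly_recurrence:
  fixes p1 p2 p3 p4 :: complex
  assumes nz: "p1 \<noteq> 0" "p2 \<noteq> 0" "p3 \<noteq> 0" "p4 \<noteq> 0" "p1 + p2 \<noteq> 0" "p1 + p3 \<noteq> 0" "p2 + p4 \<noteq> 0"
      "p3 + p4 \<noteq> 0" "p1 + p2 + p3 + p4 \<noteq> 0" "p1 * p4 - p2 * p3 \<noteq> 0"
    and le: "a + b \<le> N" "c + d \<le> N"
  defines "S \<equiv> p1 + p2 + p3 + p4"
    and "P \<equiv> \<lambda>c d. rahman_poly p1 p2 p3 p4 N (of_nat a) (of_nat b) c d"
    and "x \<equiv> of_nat c" and "y \<equiv> of_nat d" and "z \<equiv> of_nat (N - c - d)"
  shows "(of_nat a - of_nat N / 3) * P x y =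
    x * (p3 * (p1 * p4 - p2 * p3) / ((p1 + p2) * (p1 + p3) * (p3 + p4))) * P (x - 1) y
    + y * (p1 * (p2 * p3 - p1 * p4) / ((p1 + p2) * (p1 + p3) * (p3 + p4))) * P x (y - 1)
    + z * (p1 * p2 * p3 * S / ((p1 + p2) * (p1 + p3) * (p1 * p4 - p2 * p3))) * P (x + 1) y
    - y * (p1 * p2 / ((p1 + p2) * (p1 + p3))) * P (x + 1) (y - 1)
    + z * (p1 * p3 * p4 * S / ((p1 + p3) * (p3 + p4) * (p2 * p3 - p1 * p4))) * P x (y + 1)
    - x * (p3 * p4 / ((p1 + p3) * (p3 + p4))) * P (x - 1) (y + 1)
    + ((x - of_nat N / 3) * (p2 * p3 / ((p1 + p2) * (p1 + p3)) - p1 * p3 * S / ((p1 + p2) * (p1 + p3) * (p3 + p4)))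
      + (y - of_nat N / 3) * (p1 * p4 / ((p1 + p3) * (p3 + p4)) - p1 * p3 * S / ((p1 + p2) * (p1 + p3) * (p3 + p4)))) * P x y"
proof -
  have S: "S \<noteq> 0" using nz(9) by (simp add: S_def)
  have z: "z = of_nat N - x - y"
    using le(2) by (simp add: z_def x_def y_def of_nat_diff)
  define Q where "Q = p1 * p4 - p2 * p3"
  have Q: "p1 * p4 - p2 * p3 = Q" "p2 * p3 - p1 * p4 = - Q" and Qnz: "Q \<noteq> 0"
    using nz(10) by (simp_all add: Q_def)
  let ?a = "p1 + p2" and ?b = "p1 + p3" and ?d = "p3 + p4"
  let ?t = "rahman_t p1 p2 p3 p4" and ?u = "rahman_u p1 p2 p3 p4"
  let ?v = "rahman_v p1 p2 p3 p4" and ?w = "rahman_w p1 p2 p3 p4"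
  define A1 where "A1 = p3 * (p1 * p4 - p2 * p3) / (?a * ?b * ?d)"
  define A2 where "A2 = p1 * (p2 * p3 - p1 * p4) / (?a * ?b * ?d)"
  define A3 where "A3 = p1 * p2 * p3 * S / (?a * ?b * (p1 * p4 - p2 * p3))"
  define A4 where "A4 = p1 * p2 / (?a * ?b)"
  define A5 where "A5 = p1 * p3 * p4 * S / (?b * ?d * (p2 * p3 - p1 * p4))"
  define A6 where "A6 = p3 * p4 / (?b * ?d)"
  \<comment> \<open>The brackets multiplying x - N/3 and y - N/3 are \<open>C1 - C3\<close> and
    \<open>C2 - C3\<close>.\<close>
  define C1 where "C1 = p2 * p3 / (?a * ?b)"
  define C2 where "C2 = p1 * p4 / (?b * ?d)"
  define C3 where "C3 = p1 * p3 * S / (?a * ?b * ?d)"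
  note defs = rahman_t_def rahman_u_def rahman_v_def rahman_w_def S_def[symmetric]
  have vw: "?v * A3 + ?w * A5 = 0"
    using nz Qnz S unfolding defs A3_def A5_def Q by (simp add: divide_simps)
  have t3: "?t * A3 = p2 * p3 / Q"
    using nz Qnz S unfolding defs A3_def Q by (simp add: divide_simps Q_def)
  have u3: "?u * A3 = p1 * p2 * ?d / (?a * Q)"
    using nz Qnz S unfolding defs A3_def Q by (simp add: divide_simps)
  have t5: "?t * A5 = - (p3 * p4 * ?a / (?d * Q))"
    using nz Qnz S unfolding defs A5_def Q by (simp add: divide_simps)
  have u5: "?u * A5 = - (p1 * p4 / Q)"
    using nz Qnz S unfolding defs A5_def Q by (simp add: divide_simps)
  have tu: "?t * A3 + ?u * A5 = - 1"
    unfolding t3 u5 using Qnz by (simp add: divide_simps Q_def)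
  \<comment> \<open>These relations between S, \<open>Q\<close> and the linear factors let the
    numerators below factor without expanding S.\<close>
  have ab: "?a * ?b = p1 * S - Q" and bd: "?b * ?d = p3 * S + Q"
    by (simp_all add: S_def Q_def algebra_simps)
  have A4: "A3 + A4 = ?u * A3"
  proof -
    have "A3 + A4 = p1 * p2 * (p3 * S + Q) / (?a * ?b * Q)"
      using nz Qnz unfolding A3_def A4_def Q by (simp add: divide_simps) (simp add: distrib_left mult_ac)
    then show ?thesis
      using nz Qnz unfolding u3 bd[symmetric] by (simp add: divide_simps)
  qed
  have A6: "A5 + A6 = ?t * A5"
  proof -
    have "A5 + A6 = - (p3 * p4 * (p1 * S - Q) / (?b * ?d * Q))"
      using nz Qnz unfolding A5_def A6_def Q by (simp add: divide_simps) (simp add: right_diff_distrib mult_ac)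
    then show ?thesis
      using nz Qnz unfolding t5 ab[symmetric] by (simp add: divide_simps)
  qed
  have A35: "A3 + A5 = - C3"
  proof -
    have "A3 + A5 = p1 * p3 * S * (p2 * ?d - p4 * ?a) / (?a * ?b * ?d * Q)"
      using nz Qnz unfolding A3_def A5_def Q by (simp add: divide_simps) (simp add: algebra_simps)
    also have "p2 * ?d - p4 * ?a = - Q" by (simp add: Q_def algebra_simps)
    finally show ?thesis using Qnz unfolding C3_def by simp
  qed
  have A1: "A1 - A6 + C1 = 0"
    using nz unfolding A1_def A6_def C1_def by (simp add: divide_simps) (simp add: algebra_simps)
  have A2: "A2 - A4 + C2 = 0"
    using nz unfolding A2_def A4_def C2_def by (simp add: divide_simps) (simp add: algebra_simps)
  have C: "C1 + C2 + C3 = 1"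
  proof -
    have "C1 + C2 + C3 = (p2 * p3 * ?d + p1 * p4 * ?a + p1 * p3 * S) / (?a * ?b * ?d)"
      using nz unfolding C1_def C2_def C3_def by (simp add: divide_simps)
    also have "p2 * p3 * ?d + p1 * p4 * ?a + p1 * p3 * S = ?a * ?b * ?d"
      by (simp add: S_def algebra_simps)
    finally show ?thesis using nz by simp
  qed
  have B1: "C1 = A3 - ?t * A3"
  proof -
    have "A3 - ?t * A3 = p2 * p3 * (p1 * S - ?a * ?b) / (?a * ?b * Q)"
      using nz Qnz unfolding t3 unfolding A3_def Q by (simp add: divide_simps) (simp add: right_diff_distrib mult_ac)
    then show ?thesis using Qnz unfolding ab C1_def by simp
  qed
  have B2: "C2 = A5 - ?u * A5"
  proof -
    have "A5 - ?u * A5 = p1 * p4 * (?b * ?d - p3 * S) / (?b * ?d * Q)"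
      using nz Qnz unfolding u5 unfolding A5_def Q by (simp add: divide_simps) (simp add: right_diff_distrib mult_ac)
    then show ?thesis using Qnz unfolding bd C2_def by simp
  qed
  have B': "(C1 - C3) + (C2 - C3) - 1 = 3 * (A3 + A5)"
    using C A35 by algebra
  have A1': "A1 - A3 - A5 - A6 + (C1 - C3) = 0"
    using A1 A35 by algebra
  have A2': "A2 - A3 - A4 - A5 + (C2 - C3) = 0"
    using A2 A35 by algebra
  have B1': "(C1 - C3) - 2 * A3 - A5 = - ?t * A3"
    using B1 A35 by algebra
  have B2': "(C2 - C3) - A3 - 2 * A5 = - ?u * A5"
    using B2 A35 by algebra
  note rec = double_sum_rahman_kernel_recurrence[OF le B' A1' A2' B1' B2' A4 A6 tu vw]
  show ?thesis
    unfolding P_def rahman_poly_eq_double_sum[OF le(1)] z x_def y_def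
    by (rule rec[unfolded A1_def A2_def A3_def A4_def A5_def A6_def C1_def C2_def C3_def])
qed

section \<open>The four identities by symmetry\<close>

theorem theorem6p1:
  fixes p1 p2 p3 p4 S :: complex
    and N s t r \<sigma> \<tau> \<rho> :: nat
    and P :: "complex \<Rightarrow> complex \<Rightarrow> complex \<Rightarrow> complex \<Rightarrow> complex"
  assumes "p1 \<noteq> 0" and "p2 \<noteq> 0" and "p3 \<noteq> 0" and "p4 \<noteq> 0"
    and "p1 + p2 \<noteq> 0" and "p1 + p3 \<noteq> 0" and "p2 + p4 \<noteq> 0" and "p3 + p4 \<noteq> 0"
    and "p1 + p2 + p3 + p4 \<noteq> 0"
    and "p1 * p4 - p2 * p3 \<noteq> 0"
    and "s + t \<le> N" and "\<sigma> + \<tau> \<le> N"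
    and "r = N - s - t" and "\<rho> = N - \<sigma> - \<tau>"
    and "S = p1 + p2 + p3 + p4"
    and "P = rahman_poly p1 p2 p3 p4 N"
  shows
    "((of_nat s - of_nat N / 3) * P (of_nat s) (of_nat t) (of_nat \<sigma>) (of_nat \<tau>) =
       of_nat \<sigma> * (p3 * (p1 * p4 - p2 * p3) / ((p1 + p2) * (p1 + p3) * (p3 + p4))) * P (of_nat s) (of_nat t) (of_nat \<sigma> - 1) (of_nat \<tau>)
       + of_nat \<tau> * (p1 * (p2 * p3 - p1 * p4) / ((p1 + p2) * (p1 + p3) * (p3 + p4))) * P (of_nat s) (of_nat t) (of_nat \<sigma>) (of_nat \<tau> - 1)
       + of_nat \<rho> * (p1 * p2 * p3 * S / ((p1 + p2) * (p1 + p3) * (p1 * p4 - p2 * p3))) * P (of_nat s) (of_nat t) (of_nat \<sigma> + 1) (of_nat \<tau>)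
       - of_nat \<tau> * (p1 * p2 / ((p1 + p2) * (p1 + p3))) * P (of_nat s) (of_nat t) (of_nat \<sigma> + 1) (of_nat \<tau> - 1)
       + of_nat \<rho> * (p1 * p3 * p4 * S / ((p1 + p3) * (p3 + p4) * (p2 * p3 - p1 * p4))) * P (of_nat s) (of_nat t) (of_nat \<sigma>) (of_nat \<tau> + 1)
       - of_nat \<sigma> * (p3 * p4 / ((p1 + p3) * (p3 + p4))) * P (of_nat s) (of_nat t) (of_nat \<sigma> - 1) (of_nat \<tau> + 1)
       + ((of_nat \<sigma> - of_nat N / 3) * ((p2 * p3 / ((p1 + p2) * (p1 + p3))) - (p1 * p3 * S / ((p1 + p2) * (p1 + p3) * (p3 + p4))))
       + (of_nat \<tau> - of_nat N / 3) * ((p1 * p4 / ((p1 + p3) * (p3 + p4))) - (p1 * p3 * S / ((p1 + p2) * (p1 + p3) * (p3 + p4))))) * P (of_nat s) (of_nat t) (of_nat \<sigma>) (of_nat \<tau>))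
     \<and>
     ((of_nat t - of_nat N / 3) * P (of_nat s) (of_nat t) (of_nat \<sigma>) (of_nat \<tau>) =
       of_nat \<sigma> * (p4 * (p2 * p3 - p1 * p4) / ((p1 + p2) * (p2 + p4) * (p3 + p4))) * P (of_nat s) (of_nat t) (of_nat \<sigma> - 1) (of_nat \<tau>)
       + of_nat \<tau> * (p2 * (p1 * p4 - p2 * p3) / ((p1 + p2) * (p2 + p4) * (p3 + p4))) * P (of_nat s) (of_nat t) (of_nat \<sigma>) (of_nat \<tau> - 1)
       + of_nat \<rho> * (p1 * p2 * p4 * S / ((p1 + p2) * (p2 + p4) * (p2 * p3 - p1 * p4))) * P (of_nat s) (of_nat t) (of_nat \<sigma> + 1) (of_nat \<tau>)
       - of_nat \<tau> * (p1 * p2 / ((p1 + p2) * (p2 + p4))) * P (of_nat s) (of_nat t) (of_nat \<sigma> + 1) (of_nat \<tau> - 1)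
       + of_nat \<rho> * (p2 * p3 * p4 * S / ((p2 + p4) * (p3 + p4) * (p1 * p4 - p2 * p3))) * P (of_nat s) (of_nat t) (of_nat \<sigma>) (of_nat \<tau> + 1)
       - of_nat \<sigma> * (p3 * p4 / ((p2 + p4) * (p3 + p4))) * P (of_nat s) (of_nat t) (of_nat \<sigma> - 1) (of_nat \<tau> + 1)
       + ((of_nat \<sigma> - of_nat N / 3) * ((p1 * p4 / ((p1 + p2) * (p2 + p4))) - (p2 * p4 * S / ((p1 + p2) * (p2 + p4) * (p3 + p4))))
       + (of_nat \<tau> - of_nat N / 3) * ((p2 * p3 / ((p2 + p4) * (p3 + p4))) - (p2 * p4 * S / ((p1 + p2) * (p2 + p4) * (p3 + p4))))) * P (of_nat s) (of_nat t) (of_nat \<sigma>) (of_nat \<tau>))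
     \<and>
     ((of_nat \<sigma> - of_nat N / 3) * P (of_nat s) (of_nat t) (of_nat \<sigma>) (of_nat \<tau>) =
       of_nat s * (p2 * (p1 * p4 - p2 * p3) / ((p1 + p2) * (p1 + p3) * (p2 + p4))) * P (of_nat s - 1) (of_nat t) (of_nat \<sigma>) (of_nat \<tau>)
       + of_nat t * (p1 * (p2 * p3 - p1 * p4) / ((p1 + p2) * (p1 + p3) * (p2 + p4))) * P (of_nat s) (of_nat t - 1) (of_nat \<sigma>) (of_nat \<tau>)
       + of_nat r * (p1 * p2 * p3 * S / ((p1 + p2) * (p1 + p3) * (p1 * p4 - p2 * p3))) * P (of_nat s + 1) (of_nat t) (of_nat \<sigma>) (of_nat \<tau>)
       - of_nat t * (p1 * p3 / ((p1 + p2) * (p1 + p3))) * P (of_nat s + 1) (of_nat t - 1) (of_nat \<sigma>) (of_nat \<tau>)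
       + of_nat r * (p1 * p2 * p4 * S / ((p1 + p2) * (p2 + p4) * (p2 * p3 - p1 * p4))) * P (of_nat s) (of_nat t + 1) (of_nat \<sigma>) (of_nat \<tau>)
       - of_nat s * (p2 * p4 / ((p1 + p2) * (p2 + p4))) * P (of_nat s - 1) (of_nat t + 1) (of_nat \<sigma>) (of_nat \<tau>)
       + ((of_nat s - of_nat N / 3) * ((p2 * p3 / ((p1 + p2) * (p1 + p3))) - (p1 * p2 * S / ((p1 + p2) * (p1 + p3) * (p2 + p4))))
       + (of_nat t - of_nat N / 3) * ((p1 * p4 / ((p1 + p2) * (p2 + p4))) - (p1 * p2 * S / ((p1 + p2) * (p1 + p3) * (p2 + p4))))) * P (of_nat s) (of_nat t) (of_nat \<sigma>) (of_nat \<tau>))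
     \<and>
     ((of_nat \<tau> - of_nat N / 3) * P (of_nat s) (of_nat t) (of_nat \<sigma>) (of_nat \<tau>) =
       of_nat s * (p4 * (p2 * p3 - p1 * p4) / ((p1 + p3) * (p3 + p4) * (p2 + p4))) * P (of_nat s - 1) (of_nat t) (of_nat \<sigma>) (of_nat \<tau>)
       + of_nat t * (p3 * (p1 * p4 - p2 * p3) / ((p1 + p3) * (p3 + p4) * (p2 + p4))) * P (of_nat s) (of_nat t - 1) (of_nat \<sigma>) (of_nat \<tau>)
       + of_nat r * (p1 * p3 * p4 * S / ((p1 + p3) * (p3 + p4) * (p2 * p3 - p1 * p4))) * P (of_nat s + 1) (of_nat t) (of_nat \<sigma>) (of_nat \<tau>)
       - of_nat t * (p1 * p3 / ((p1 + p3) * (p3 + p4))) * P (of_nat s + 1) (of_nat t - 1) (of_nat \<sigma>) (of_nat \<tau>)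
       + of_nat r * (p2 * p3 * p4 * S / ((p2 + p4) * (p3 + p4) * (p1 * p4 - p2 * p3))) * P (of_nat s) (of_nat t + 1) (of_nat \<sigma>) (of_nat \<tau>)
       - of_nat s * (p2 * p4 / ((p2 + p4) * (p3 + p4))) * P (of_nat s - 1) (of_nat t + 1) (of_nat \<sigma>) (of_nat \<tau>)
       + ((of_nat s - of_nat N / 3) * ((p1 * p4 / ((p1 + p3) * (p3 + p4))) - (p3 * p4 * S / ((p1 + p3) * (p3 + p4) * (p2 + p4))))
       + (of_nat t - of_nat N / 3) * ((p2 * p3 / ((p2 + p4) * (p3 + p4))) - (p3 * p4 * S / ((p1 + p3) * (p3 + p4) * (p2 + p4))))) * P (of_nat s) (of_nat t) (of_nat \<sigma>) (of_nat \<tau>))"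
    (is "?g1 \<and> ?g2 \<and> ?g3 \<and> ?g4")
proof (intro conjI)
  have nz: "p2 + p1 \<noteq> 0" "p3 + p1 \<noteq> 0" "p4 + p2 \<noteq> 0" "p4 + p3 \<noteq> 0"
      "p2 + p1 + p4 + p3 \<noteq> 0" "p1 + p3 + p2 + p4 \<noteq> 0" "p3 + p1 + p4 + p2 \<noteq> 0"
      "p2 * p3 - p1 * p4 \<noteq> 0" "p1 * p4 - p3 * p2 \<noteq> 0" "p3 * p2 - p1 * p4 \<noteq> 0"
    using assms(5-10) by (auto simp: ac_simps)
  note S = assms(15) and P = assms(16) and r = assms(13) and \<rho> = assms(14)
  have t_s: "t + s \<le> N" and \<tau>_\<sigma>: "\<tau> + \<sigma> \<le> N"
    using assms(11,12) by simp_all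
  show ?g1
    unfolding S P \<rho> by (rule rahman_poly_recurrence) (fact assms)+
  \<comment> \<open>Exchanging phi and psi makes t the first argument.\<close>
  have "rahman_poly p2 p1 p4 p3 N (of_nat t) (of_nat s) c d = P (of_nat s) (of_nat t) c d" for c d
    unfolding P by (rule rahman_poly_swap_pairs)
  with rahman_poly_recurrence[OF assms(2,1,4,3) nz(1) assms(7,6) nz(4,5,8) t_s assms(12)]
  show ?g2
    unfolding S \<rho> by (simp only: ac_simps)
  \<comment> \<open>Transposition lets the difference operator act on (s, t), with \<sigma> in the
    role of the eigenvalue.\<close>
  have "rahman_poly p1 p3 p2 p4 N (of_nat \<sigma>) (of_nat \<tau>) a b = P a b (of_nat \<sigma>) (of_nat \<tau>)" for a b
    unfolding P by (rule rahman_poly_transpose)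
  with rahman_poly_recurrence[OF assms(1,3,2,4,6,5,8,7) nz(6,9) assms(12,11)]
  show ?g3
    unfolding S r by (simp only: ac_simps)
  \<comment> \<open>Both symmetries are composed, which brings \<tau> to the first place.\<close>
  have "rahman_poly p3 p1 p4 p2 N (of_nat \<tau>) (of_nat \<sigma>) a b = P a b (of_nat \<sigma>) (of_nat \<tau>)" for a b
    unfolding P rahman_poly_swap_pairs[of p3 p1 p4 p2] by (rule rahman_poly_transpose)
  with rahman_poly_recurrence[OF assms(3,1,4,2) nz(2) assms(8,5) nz(3,7,10) \<tau>_\<sigma> assms(11)]
  show ?g4
    unfolding S r by (simp only: ac_simps)
qed

end
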